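(* Let $\Bbbk$ be a field, let $n,m\ge 1$, and let $\mathbf p\in\mathcal A_n$ and $\mathbf q\in\mathcal A_m$ be multiplicatively antisymmetric matrices over $\Bbbk$. Then $\mathcal O_{\mathbf p}(\Bbbk^n)\cong\mathcal O_{\mathbf q}(\Bbbk^m)$ as $\Bbbk$-algebras if and only if $m=n$ and $\mathbf p$ is a permutation of $\mathbf q$.
   Context: $\mathcal A_n\subset \mathcal M_n(\Bbbk^\times)$ is the set of multiplicatively antisymmetric matrices: $\mathbf p=(p_{ij})$ with all $p_{ij}\in\Bbbk^\times$, $p_{ii}=1$ and $p_{ij}=p_{ji}^{-1}$ for all $i\ne j$. For two matrices $\mathbf p,\mathbf q\in\mathcal A_n$, one is a permutation of the other if there is $\sigma\in\mathcal S_n$ such that $p_{ij}=q_{\sigma(i)\sigma(j)}$ for all $i,j$. For $\mathbf p\in\mathcal A_n$, the multiparameter quantum affine $n$-space $\mathcal O_{\mathbf p}(\Bbbk^n)$ is the unital associative $\Bbbk$-algebra generated by $x_1,\dots,x_n$ subject to the relations $x_ix_j=p_{ij}x_jx_i$ for all $1\le i,j\le n$. *)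

theory Defs
  imports
    "HOL-Algebra.QuotRing"
    "HOL-Library.Poly_Mapping"
    "HOL-Combinatorics.Permutations"
    "Jordan_Normal_Form.Matrix"
begin

section \<open>Multiplicatively antisymmetric matrices\<close>

text \<open>Matrix rows and columns are indexed by $0,\dots,n-1$.\<close>

definition mult_antisym_mat :: "nat \<Rightarrow> 'k::field mat set" where
  "mult_antisym_mat n = {p \<in> carrier_mat n n.
     (\<forall>i<n. \<forall>j<n. p $$ (i, j) \<noteq> 0) \<and>
     (\<forall>i<n. p $$ (i, i) = 1) \<and>
     (\<forall>i<n. \<forall>j<n. i \<noteq> j \<longrightarrow> p $$ (i, j) = inverse (p $$ (j, i)))}"

definition is_mat_permutation :: "nat \<Rightarrow> 'k mat \<Rightarrow> 'k mat \<Rightarrow> bool" where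
  "is_mat_permutation n p q \<longleftrightarrow>
     (\<exists>\<sigma>. \<sigma> permutes {..<n} \<and> (\<forall>i<n. \<forall>j<n. p $$ (i, j) = q $$ (\<sigma> i, \<sigma> j)))"


section \<open>The free algebra\<close>

text \<open>
  Words form a monoid under concatenation. It has to be written additively, because the product of
  \<^typ>\<open>'a \<Rightarrow>\<^sub>0 'b\<close> is the convolution over the additive monoid \<^typ>\<open>'a\<close>. With this instance,
  \<^typ>\<open>nat list \<Rightarrow>\<^sub>0 'k\<close> is the free algebra on countably many generators.
\<close>

instantiation list :: (type) monoid_add
begin

definition zero_list :: "'a list" where
  "zero_list = []"

definition plus_list :: "'a list \<Rightarrow> 'a list \<Rightarrow> 'a list" where
  "plus_list = (@)"

instance
  by standard (simp_all add: zero_list_def plus_list_def)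

end

text \<open>
  Associative \<open>'k\<close>-algebras are represented by \<^typ>\<open>('k, 'a) module\<close> records, i.e. rings with a scalar
  multiplication. (The locale \<^locale>\<open>algebra\<close> requires commutativity and is not used.)
\<close>

definition free_algebra :: "nat \<Rightarrow> ('k::field, nat list \<Rightarrow>\<^sub>0 'k) module" where
  "free_algebra n = \<lparr>
     carrier = {f. Poly_Mapping.keys f \<subseteq> lists {..<n}},
     monoid.mult = (*), one = 1, zero = 0, add = (+),
     smult = (\<lambda>c. Poly_Mapping.map ((*) c))\<rparr>"

definition gen :: "nat \<Rightarrow> (nat list \<Rightarrow>\<^sub>0 'k::field)" where
  "gen i = Poly_Mapping.single [i] 1"


section \<open>Quotients and isomorphisms of algebras\<close>

text \<open>
  The scalar multiplication is lifted to cosets in the same way as \<^const>\<open>rcoset_mult\<close> lifts the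
  product.
\<close>

definition quot_algebra :: "('k, 'a) module \<Rightarrow> 'a set \<Rightarrow> ('k, 'a set) module" where
  "quot_algebra A I = ring.extend (A Quot I)
     (module.fields (\<lambda>c X. \<Union>x\<in>X. I +>\<^bsub>A\<^esub> (c \<odot>\<^bsub>A\<^esub> x)))"

definition algebra_iso :: "('k, 'a) module \<Rightarrow> ('k, 'b) module \<Rightarrow> ('a \<Rightarrow> 'b) set" where
  "algebra_iso A B = {h \<in> ring_iso A B. \<forall>c. \<forall>x\<in>carrier A. h (c \<odot>\<^bsub>A\<^esub> x) = c \<odot>\<^bsub>B\<^esub> h x}"

definition algebra_isomorphic :: "('k, 'a) module \<Rightarrow> ('k, 'b) module \<Rightarrow> bool"
    (infix \<open>\<simeq>\<^sub>a\<^sub>l\<^sub>g\<close> 50) where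
  "A \<simeq>\<^sub>a\<^sub>l\<^sub>g B \<longleftrightarrow> algebra_iso A B \<noteq> {}"


section \<open>Multiparameter quantum affine space\<close>

definition quantum_relations :: "nat \<Rightarrow> 'k::field mat \<Rightarrow> (nat list \<Rightarrow>\<^sub>0 'k) set" where
  "quantum_relations n p =
     {gen i * gen j - Poly_Mapping.map ((*) (p $$ (i, j))) (gen j * gen i) | i j. i < n \<and> j < n}"

text \<open>\<^const>\<open>genideal\<close> is the two-sided ideal generated by a set.\<close>

definition quantum_affine_space ::
    "nat \<Rightarrow> 'k::field mat \<Rightarrow> ('k, (nat list \<Rightarrow>\<^sub>0 'k) set) module" where
  "quantum_affine_space n p =
     quot_algebra (free_algebra n) (Idl\<^bsub>free_algebra n\<^esub> (quantum_relations n p))"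


section \<open>Basic facts\<close>

lemma free_algebra_simps [simp]:
  "carrier (free_algebra n) = {f. Poly_Mapping.keys f \<subseteq> lists {..<n}}"
  "monoid.mult (free_algebra n) = (*)"
  "one (free_algebra n) = 1"
  "zero (free_algebra n) = 0"
  "add (free_algebra n) = (+)"
  "smult (free_algebra n) c = Poly_Mapping.map ((*) c)"
  by (simp_all add: free_algebra_def)

lemma quot_algebra_simps:
  "carrier (quot_algebra A I) = a_rcosets\<^bsub>A\<^esub> I"
  "monoid.mult (quot_algebra A I) = rcoset_mult A I"
  "one (quot_algebra A I) = I +>\<^bsub>A\<^esub> \<one>\<^bsub>A\<^esub>"
  "zero (quot_algebra A I) = I"
  "add (quot_algebra A I) = set_add A"
  "smult (quot_algebra A I) c X = (\<Union>x\<in>X. I +>\<^bsub>A\<^esub> (c \<odot>\<^bsub>A\<^esub> x))"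
  by (simp_all add: quot_algebra_def FactRing_def ring.defs module.defs)

lemma keys_mult_lists:
  fixes f g :: "'a list \<Rightarrow>\<^sub>0 'k::field"
  assumes "Poly_Mapping.keys f \<subseteq> lists S" "Poly_Mapping.keys g \<subseteq> lists S"
  shows "Poly_Mapping.keys (f * g) \<subseteq> lists S"
  using keys_mult[of f g] assms unfolding plus_list_def by fastforce

lemma smult_conv_mult:
  "Poly_Mapping.map ((*) c) f = Poly_Mapping.single [] c * (f :: nat list \<Rightarrow>\<^sub>0 'k::field)"
  using mult_map_scale_conv_mult[of c f] by (simp add: zero_list_def)

lemma ring_free_algebra: "ring (free_algebra n :: ('k::field, _) module)"
proof (rule ringI)
  show "abelian_group (free_algebra n :: ('k, _) module)"
  proof (rule abelian_groupI, goal_cases)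
    case (1 x y)
    then show ?case using keys_add[of x y] by auto
  next
    case (6 x)
    then show ?case by (auto intro!: exI[of _ "- x"])
  qed (auto simp: ac_simps)
  show "Group.monoid (free_algebra n :: ('k, _) module)"
  proof (rule monoidI, goal_cases)
    case (1 x y)
    then show ?case using keys_mult_lists[of x "{..<n}" y] by simp
  qed (auto simp: mult.assoc zero_list_def)
qed (auto simp: distrib_left distrib_right)

lemma quantum_relations_carrier:
  "quantum_relations n p \<subseteq> carrier (free_algebra n)"
proof
  fix r assume "r \<in> quantum_relations n p"
  then obtain i j where ij: "i < n" "j < n"
    and r: "r = gen i * gen j - Poly_Mapping.map ((*) (p $$ (i, j))) (gen j * gen i)"
    by (auto simp: quantum_relations_def)
  have "r = Poly_Mapping.single [i, j] 1 + Poly_Mapping.single [j, i] (- (p $$ (i, j)))"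
    by (simp add: r gen_def mult_single smult_conv_mult plus_list_def single_uminus)
  then show "r \<in> carrier (free_algebra n)"
    using ij keys_add[of "Poly_Mapping.single [i, j] 1" "Poly_Mapping.single [j, i] (- (p $$ (i, j)))"]
    by (auto split: if_splits)
qed

lemma ideal_quantum_relations:
  "ideal (Idl\<^bsub>free_algebra n\<^esub> (quantum_relations n p)) (free_algebra n)"
  by (rule ring.genideal_ideal[OF ring_free_algebra quantum_relations_carrier])

lemma ring_quot_algebra:
  assumes "ideal I A"
  shows "ring (quot_algebra A I)"
proof -
  interpret Q: ring "A Quot I"
    using assms by (rule ideal.quotient_is_ring)
  have eqs: "carrier (quot_algebra A I) = carrier (A Quot I)"
    "monoid.mult (quot_algebra A I) = monoid.mult (A Quot I)"
    "one (quot_algebra A I) = one (A Quot I)"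
    "zero (quot_algebra A I) = zero (A Quot I)"
    "add (quot_algebra A I) = add (A Quot I)"
    by (simp_all add: quot_algebra_simps FactRing_def)
  show ?thesis
  proof (rule ringI)
    show "abelian_group (quot_algebra A I)"
      by (rule abelian_groupI) (auto simp: eqs Q.a_ac intro: Q.add.l_inv_ex)
    show "Group.monoid (quot_algebra A I)"
      by (rule monoidI) (auto simp: eqs Q.m_assoc)
  qed (auto simp: eqs Q.l_distr Q.r_distr)
qed

lemma ring_quantum_affine_space: "ring (quantum_affine_space n p)"
  unfolding quantum_affine_space_def by (rule ring_quot_algebra[OF ideal_quantum_relations])

lemma smult_quantum_affine_space:
  fixes p :: "'k::field mat" and n :: nat
  defines "I \<equiv> Idl\<^bsub>free_algebra n\<^esub> (quantum_relations n p)"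
  assumes x: "x \<in> carrier (free_algebra n)"
  shows "c \<odot>\<^bsub>quantum_affine_space n p\<^esub> (I +>\<^bsub>free_algebra n\<^esub> x) =
         I +>\<^bsub>free_algebra n\<^esub> (c \<odot>\<^bsub>free_algebra n\<^esub> x)"
proof -
  interpret ideal I "free_algebra n"
    unfolding I_def by (rule ideal_quantum_relations)
  let ?c = "Poly_Mapping.single [] c"
  have c: "?c \<in> carrier (free_algebra n)" by simp
  have eq: "I +>\<^bsub>free_algebra n\<^esub> (?c * y) = I +>\<^bsub>free_algebra n\<^esub> (?c * x)"
    if yx: "y \<in> I +>\<^bsub>free_algebra n\<^esub> x" for y
  proof -
    obtain h where h: "h \<in> I" and "y = h \<oplus>\<^bsub>free_algebra n\<^esub> x"
      using yx unfolding a_r_coset_def' by blast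
    then have y: "y = h + x" by simp
    have hx: "?c * h \<in> I" using I_l_closed[OF h c] by simp
    have cx: "?c * x \<in> carrier (free_algebra n)" using m_closed[OF c x] by simp
    have "?c * y \<in> I +>\<^bsub>free_algebra n\<^esub> (?c * x)"
      unfolding a_r_coset_def' y distrib_left using hx by force
    then show ?thesis by (rule a_repr_independence[OF _ cx a_subgroup, symmetric])
  qed
  have "(\<Union>y\<in>I +>\<^bsub>free_algebra n\<^esub> x. I +>\<^bsub>free_algebra n\<^esub> (?c * y)) =
        I +>\<^bsub>free_algebra n\<^esub> (?c * x)"
    using eq a_rcos_self[OF x] by blast
  then show ?thesis
    by (simp add: quantum_affine_space_def quot_algebra_simps smult_conv_mult flip: I_def)
qed

end

theory Submission
  imports Defs "Jordan_Normal_Form.Determinant"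
begin

text \<open>
  The images of the generators under an isomorphism and its inverse give noncommutative polynomials
  \<open>F\<close> and \<open>G\<close> that transform solutions of the two sets of relations, in any \<open>k\<close>-algebra, bijectively
  into each other. Solutions are taken among upper triangular $3 \times 3$ matrices with constant
  diagonal, which see first derivatives and products of two tangent vectors. Tangent vectors at $0$
  are unrestricted, so comparing Jacobians at $0$ and at $\alpha = G(0)$ gives $n \le m$, hence $n = m$,
  and then tangent vectors at $\alpha$ are unrestricted too. This forces
  $\alpha_i (1 - q_{ij}) = 0$, i.e. \<open>x\<^sub>i\<close> is central whenever $\alpha_i \ne 0$, so that pairs of tangent
  vectors obey the same quadratic equations $u_i v_j = q_{ij} u_j v_i$ at $\alpha$ as at $0$, and the
  invertible Jacobian $D$ of \<open>F\<close> at $\alpha$ maps these equations to those of \<open>p\<close>. If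
  $q_{ab} \ne 1$ and $D_{ia} D_{ib} \ne 0$, the equations make columns \<open>a\<close> and \<open>b\<close> of $D$
  proportional, which is impossible. Consequently every permutation $\sigma$ with
  $\prod_i D_{i\sigma(i)} \ne 0$ transforms \<open>q\<close> into \<open>p\<close>.
\<close>

section \<open>Evaluation of noncommutative polynomials\<close>

lemma poly_mapping_eq_sum_single:
  fixes f :: "'a \<Rightarrow>\<^sub>0 'b::comm_monoid_add"
  shows "f = (\<Sum>w\<in>Poly_Mapping.keys f. Poly_Mapping.single w (Poly_Mapping.lookup f w))"
  by (rule poly_mapping_eqI)
    (auto simp: lookup_sum lookup_single when_def in_keys_iff)

text \<open>The sum of the monomials of \<open>f\<close> is built one word at a time; all partial
  sums keep their support in \<open>S\<close>, as the \<open>add\<close> case demands.\<close>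

lemma poly_mapping_single_add_induct [consumes 1, case_names zero single add]:
  fixes f :: "'a \<Rightarrow>\<^sub>0 'b::comm_monoid_add"
  assumes "Poly_Mapping.keys f \<subseteq> S"
    and "P 0"
    and "\<And>w a. w \<in> S \<Longrightarrow> P (Poly_Mapping.single w a)"
    and "\<And>f g. \<lbrakk>Poly_Mapping.keys f \<subseteq> S; Poly_Mapping.keys g \<subseteq> S; P f; P g\<rbrakk> \<Longrightarrow> P (f + g)"
  shows "P f"
proof -
  have "P (\<Sum>w\<in>T. Poly_Mapping.single w (Poly_Mapping.lookup f w)) \<and>
        Poly_Mapping.keys (\<Sum>w\<in>T. Poly_Mapping.single w (Poly_Mapping.lookup f w)) \<subseteq> S"
    if "finite T" "T \<subseteq> S" for T
    using that
  proof (induction T)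
    case empty
    then show ?case using assms(2) by simp
  next
    case (insert w T)
    let ?s = "Poly_Mapping.single w (Poly_Mapping.lookup f w)"
    let ?t = "\<Sum>w\<in>T. Poly_Mapping.single w (Poly_Mapping.lookup f w)"
    have "Poly_Mapping.keys ?s \<subseteq> S" using insert by auto
    then have "P (?s + ?t) \<and> Poly_Mapping.keys (?s + ?t) \<subseteq> S"
      using insert assms(3,4) keys_add[of ?s ?t] by (meson insert_subset order.trans Un_least)
    then show ?case using insert by simp
  qed
  from this[OF finite_keys assms(1)] show ?thesis
    using poly_mapping_eq_sum_single[of f] by simp
qed

text \<open>A monomial loses its letters from the left, one generator at a time, until its
  coefficient is left on the empty word. The base case therefore covers all constants.\<close>

lemma free_algebra_induct [consumes 1, case_names const gen add mult]:
  fixes f :: "nat list \<Rightarrow>\<^sub>0 'k::field"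
  assumes "f \<in> carrier (free_algebra n)"
    and const: "\<And>a. P (Poly_Mapping.single [] a)"
    and gen: "\<And>i. i < n \<Longrightarrow> P (gen i)"
    and add: "\<And>f g. \<lbrakk>f \<in> carrier (free_algebra n); g \<in> carrier (free_algebra n); P f; P g\<rbrakk> \<Longrightarrow> P (f + g)"
    and mult: "\<And>f g. \<lbrakk>f \<in> carrier (free_algebra n); g \<in> carrier (free_algebra n); P f; P g\<rbrakk> \<Longrightarrow> P (f * g)"
  shows "P f"
proof -
  have "Poly_Mapping.keys f \<subseteq> lists {..<n}" using assms(1) by simp
  then show ?thesis
  proof (induction f rule: poly_mapping_single_add_induct)
    case zero
    then show ?case using const[of 0] by simp
  next
    case (single w a)
    then show ?case
    proof (induction w)
      case Nil
      then show ?case by (rule const)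
    next
      case (Cons i w)
      have "Poly_Mapping.single (i # w) a = gen i * Poly_Mapping.single w a"
        by (simp add: gen_def mult_single plus_list_def)
      moreover have "P (gen i * Poly_Mapping.single w a)"
        using Cons by (intro mult gen) (auto simp: gen_def)
      ultimately show ?case by simp
    qed
  next
    case (add f g)
    then show ?case using assms(4) by simp
  qed
qed

lemma free_algebra_closed:
  "Poly_Mapping.single [] a \<in> carrier (free_algebra n)"
  "i < n \<Longrightarrow> gen i \<in> carrier (free_algebra n)"
  "\<lbrakk>f \<in> carrier (free_algebra n); g \<in> carrier (free_algebra n)\<rbrakk> \<Longrightarrow> f + g \<in> carrier (free_algebra n)"
  "\<lbrakk>f \<in> carrier (free_algebra n); g \<in> carrier (free_algebra n)\<rbrakk> \<Longrightarrow> f - g \<in> carrier (free_algebra n)"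
  "\<lbrakk>f \<in> carrier (free_algebra n); g \<in> carrier (free_algebra n)\<rbrakk> \<Longrightarrow> f * g \<in> carrier (free_algebra n)"
  for f g :: "nat list \<Rightarrow>\<^sub>0 'k::field"
  using keys_add[of f g] keys_diff[of f g] keys_mult_lists[of f "{..<n}" g] by (auto simp: gen_def)

text \<open>The structure map of an associative unital \<open>k\<close>-algebra, kept apart from the
  ring type, so that substitution of polynomials and evaluation at matrices are instances of one
  \<open>eval\<close>.\<close>

locale scalar_embedding =
  fixes \<iota> :: "'k::field \<Rightarrow> 'r::ring_1"
  assumes scalar_add: "\<iota> (a + b) = \<iota> a + \<iota> b"
    and scalar_mult: "\<iota> (a * b) = \<iota> a * \<iota> b"
    and scalar_one: "\<iota> 1 = 1"
    and scalar_central: "\<iota> a * x = x * \<iota> a"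
begin

lemma scalar_zero: "\<iota> 0 = 0"
  using scalar_add[of 0 0] by simp

definition eval :: "(nat \<Rightarrow> 'r) \<Rightarrow> (nat list \<Rightarrow>\<^sub>0 'k) \<Rightarrow> 'r" where
  "eval c f = (\<Sum>w\<in>Poly_Mapping.keys f. \<iota> (Poly_Mapping.lookup f w) * prod_list (map c w))"

lemma eval_superset:
  assumes "finite S" "Poly_Mapping.keys f \<subseteq> S"
  shows "eval c f = (\<Sum>w\<in>S. \<iota> (Poly_Mapping.lookup f w) * prod_list (map c w))"
  unfolding eval_def using assms
  by (intro sum.mono_neutral_left) (auto simp: in_keys_iff scalar_zero)

lemma eval_add: "eval c (f + g) = eval c f + eval c g"
proof -
  let ?S = "Poly_Mapping.keys f \<union> Poly_Mapping.keys g"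
  show ?thesis
    using keys_add[of f g]
    by (simp add: eval_superset[of ?S] lookup_add scalar_add distrib_right sum.distrib)
qed

lemma eval_zero: "eval c 0 = 0"
  by (simp add: eval_def)

lemma eval_diff: "eval c (f - g) = eval c f - eval c g"
  using eval_add[of c "f - g" g] by simp

lemma eval_single: "eval c (Poly_Mapping.single w a) = \<iota> a * prod_list (map c w)"
  by (simp add: eval_superset[of "{w}"])

lemma eval_const: "eval c (Poly_Mapping.single [] a) = \<iota> a"
  by (simp add: eval_single)

lemma eval_gen: "eval c (gen i) = c i"
  by (simp add: gen_def eval_single scalar_one)

lemma eval_mult_single:
  "eval c (Poly_Mapping.single v a * Poly_Mapping.single w b) =
   eval c (Poly_Mapping.single v a) * eval c (Poly_Mapping.single w b)"
  by (simp add: mult_single eval_single plus_list_def scalar_mult mult.assoc)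
    (metis mult.assoc scalar_central)

text \<open>Additivity in both factors reduces this to two monomials, where
  \<open>scalar_central\<close> moves the second coefficient past the first word.\<close>

lemma eval_mult: "eval c (f * g) = eval c f * eval c g"
proof -
  have "Poly_Mapping.keys f \<subseteq> UNIV" "Poly_Mapping.keys g \<subseteq> UNIV" by simp_all
  then show ?thesis
  proof (induction f rule: poly_mapping_single_add_induct)
    case (single v a)
    show ?case using \<open>Poly_Mapping.keys g \<subseteq> UNIV\<close>
      by (induction g rule: poly_mapping_single_add_induct)
        (simp_all add: eval_zero eval_mult_single eval_add distrib_left)
  qed (simp_all add: eval_zero eval_add distrib_right)
qed

lemmas eval_simps = eval_zero eval_add eval_diff eval_mult eval_const eval_gen

lemma eval_cong:
  assumes "f \<in> carrier (free_algebra n)" "\<And>i. i < n \<Longrightarrow> c i = c' i"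
  shows "eval c f = eval c' f"
  using assms by (induction rule: free_algebra_induct) (simp_all add: eval_simps)

text \<open>These tuples are the points of the quantum affine space with values in the algebra
  \<open>'r\<close>: by \<open>eval_quantum_ideal\<close>, evaluation at them descends to the
  quotient.\<close>

definition quantum_tuple :: "nat \<Rightarrow> 'k mat \<Rightarrow> (nat \<Rightarrow> 'r) \<Rightarrow> bool" where
  "quantum_tuple n p c \<longleftrightarrow> (\<forall>i<n. \<forall>j<n. c i * c j = \<iota> (p $$ (i, j)) * (c j * c i))"

lemma quantum_tuple_cong:
  assumes "\<And>i. i < n \<Longrightarrow> c i = c' i"
  shows "quantum_tuple n p c \<longleftrightarrow> quantum_tuple n p c'"
  unfolding quantum_tuple_def by (intro iff_allI imp_cong refl) (simp only: assms)

end

text \<open>With the free algebra as target, \<open>free.eval F\<close> is the substitution of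
  \<open>F i\<close> for the generator \<open>gen i\<close>.\<close>

interpretation free: scalar_embedding "Poly_Mapping.single [] :: 'k::field \<Rightarrow> nat list \<Rightarrow>\<^sub>0 'k"
proof
  fix a :: 'k and x :: "nat list \<Rightarrow>\<^sub>0 'k"
  have "Poly_Mapping.keys x \<subseteq> UNIV" by simp
  then show "Poly_Mapping.single [] a * x = x * Poly_Mapping.single [] a"
    by (induction x rule: poly_mapping_single_add_induct)
      (simp_all add: mult_single plus_list_def mult.commute distrib_left distrib_right)
next
  show "Poly_Mapping.single [] 1 = (1 :: nat list \<Rightarrow>\<^sub>0 'k)"
    by (simp flip: zero_list_def)
qed (simp_all add: single_add mult_single plus_list_def)

lemma free_eval_gen:
  assumes "f \<in> carrier (free_algebra n)"
  shows "free.eval gen f = f"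
  using assms by (induction rule: free_algebra_induct) (simp_all add: free.eval_simps)

lemma free_eval_closed:
  assumes "f \<in> carrier (free_algebra n)" "\<And>i. i < n \<Longrightarrow> F i \<in> carrier (free_algebra m)"
  shows "free.eval F f \<in> carrier (free_algebra m)"
  using assms
  by (induction rule: free_algebra_induct)
    (simp_all only: free.eval_simps free_algebra_closed)

text \<open>Both sides are additive and multiplicative in \<open>f\<close> and agree on constants
  and generators.\<close>

lemma (in scalar_embedding) eval_free_eval:
  assumes "f \<in> carrier (free_algebra n)"
  shows "eval c (free.eval F f) = eval (\<lambda>i. eval c (F i)) f"
  using assms
  by (induction rule: free_algebra_induct) (simp_all add: eval_simps free.eval_simps)

section \<open>The quotient map\<close>

abbreviation quantum_ideal :: "nat \<Rightarrow> 'k::field mat \<Rightarrow> (nat list \<Rightarrow>\<^sub>0 'k) set" where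
  "quantum_ideal n p \<equiv> Idl\<^bsub>free_algebra n\<^esub> (quantum_relations n p)"

definition quantum_proj :: "nat \<Rightarrow> 'k::field mat \<Rightarrow> (nat list \<Rightarrow>\<^sub>0 'k) \<Rightarrow> (nat list \<Rightarrow>\<^sub>0 'k) set" where
  "quantum_proj n p f = quantum_ideal n p +>\<^bsub>free_algebra n\<^esub> f"

text \<open>The scalar enters as a constant polynomial, so that \<open>eval_mult\<close> and
  \<open>eval_const\<close> compute the value of a relation.\<close>

definition quantum_rel :: "'k::field mat \<Rightarrow> nat \<Rightarrow> nat \<Rightarrow> (nat list \<Rightarrow>\<^sub>0 'k)" where
  "quantum_rel p i j = gen i * gen j - Poly_Mapping.single [] (p $$ (i, j)) * (gen j * gen i)"

lemma quantum_relations_eq: "quantum_relations n p = {quantum_rel p i j | i j. i < n \<and> j < n}"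
  by (simp add: quantum_relations_def quantum_rel_def smult_conv_mult)

lemma free_algebra_a_minus:
  fixes f g :: "nat list \<Rightarrow>\<^sub>0 'k::field"
  assumes "f \<in> carrier (free_algebra n)" "g \<in> carrier (free_algebra n)"
  shows "f \<ominus>\<^bsub>free_algebra n\<^esub> g = f - g"
proof -
  interpret ring "free_algebra n :: ('k, _) module" by (rule ring_free_algebra)
  have "- g \<in> carrier (free_algebra n)" using assms by simp
  then have "\<ominus>\<^bsub>free_algebra n\<^esub> g = - g"
    using assms minus_equality[of "- g" g] by simp
  then show ?thesis by (simp add: a_minus_def)
qed

lemma quantum_proj_eq_iff:
  assumes "f \<in> carrier (free_algebra n)" "g \<in> carrier (free_algebra n)"
  shows "quantum_proj n p f = quantum_proj n p g \<longleftrightarrow> f - g \<in> quantum_ideal n p"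
  using ring.quotient_eq_iff_same_a_r_cos[OF ring_free_algebra ideal_quantum_relations assms, of p]
    free_algebra_a_minus[OF assms]
  by (simp add: quantum_proj_def)

lemma quantum_affine_space_carrier:
  "carrier (quantum_affine_space n p) = quantum_proj n p ` carrier (free_algebra n)"
  by (auto simp: quantum_affine_space_def quot_algebra_simps quantum_proj_def A_RCOSETS_def'
      simp del: free_algebra_simps)

lemma quantum_proj_one: "quantum_proj n p 1 = \<one>\<^bsub>quantum_affine_space n p\<^esub>"
  by (simp add: quantum_affine_space_def quantum_proj_def quot_algebra_simps)

lemma quantum_proj_add:
  assumes "f \<in> carrier (free_algebra n)" "g \<in> carrier (free_algebra n)"
  shows "quantum_proj n p (f + g) =
    quantum_proj n p f \<oplus>\<^bsub>quantum_affine_space n p\<^esub> quantum_proj n p g"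
  using ring_hom_memE(3)[OF ideal.rcos_ring_hom[OF ideal_quantum_relations] assms, of p]
  by (simp add: quantum_affine_space_def quantum_proj_def quot_algebra_simps FactRing_def)

lemma quantum_proj_mult:
  assumes "f \<in> carrier (free_algebra n)" "g \<in> carrier (free_algebra n)"
  shows "quantum_proj n p (f * g) =
    quantum_proj n p f \<otimes>\<^bsub>quantum_affine_space n p\<^esub> quantum_proj n p g"
  using ring_hom_memE(2)[OF ideal.rcos_ring_hom[OF ideal_quantum_relations] assms, of p]
  by (simp add: quantum_affine_space_def quantum_proj_def quot_algebra_simps FactRing_def)

lemma quantum_proj_smult:
  assumes "f \<in> carrier (free_algebra n)"
  shows "quantum_proj n p (Poly_Mapping.single [] a * f) =
    a \<odot>\<^bsub>quantum_affine_space n p\<^esub> quantum_proj n p f"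
  using smult_quantum_affine_space[OF assms, where c = a and p = p]
  by (simp add: quantum_proj_def smult_conv_mult)

lemma quantum_rel_in_ideal:
  assumes "i < n" "j < n"
  shows "quantum_rel p i j \<in> quantum_ideal n p"
  using ring.genideal_self[OF ring_free_algebra quantum_relations_carrier, of n p] assms
  by (auto simp: quantum_relations_eq)

lemma quantum_ideal_carrier:
  "f \<in> quantum_ideal n p \<Longrightarrow> f \<in> carrier (free_algebra n)"
  by (rule ideal.Icarr[OF ideal_quantum_relations])

text \<open>Closure under differences together with \<open>0\<close> yields negatives and sums,
  hence an additive subgroup. Ideal membership can then be treated with ordinary polynomial
  arithmetic.\<close>

lemma quantum_ideal_minimal:
  fixes p :: "'a::field mat"
  assumes rel: "\<And>i j. \<lbrakk>i < n; j < n\<rbrakk> \<Longrightarrow> quantum_rel p i j \<in> J"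
    and sub: "J \<subseteq> carrier (free_algebra n)"
    and "0 \<in> J" and diff: "\<And>f g. \<lbrakk>f \<in> J; g \<in> J\<rbrakk> \<Longrightarrow> f - g \<in> J"
    and "\<And>f g. \<lbrakk>f \<in> J; g \<in> carrier (free_algebra n)\<rbrakk> \<Longrightarrow> g * f \<in> J"
    and "\<And>f g. \<lbrakk>f \<in> J; g \<in> carrier (free_algebra n)\<rbrakk> \<Longrightarrow> f * g \<in> J"
  shows "quantum_ideal n p \<subseteq> J"
proof (rule ring.genideal_minimal[OF ring_free_algebra])
  interpret ring "free_algebra n :: ('a, _) module" by (rule ring_free_algebra)
  show "ideal J (free_algebra n)"
  proof (rule idealI[OF ring_free_algebra])
    have neg: "- f \<in> J" if "f \<in> J" for f using diff[OF \<open>0 \<in> J\<close> that] by simp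
    have inv: "\<ominus>\<^bsub>free_algebra n\<^esub> f = - f" if "f \<in> J" for f
      using minus_equality[of "- f" f] sub that neg[OF that] by auto
    have add: "f + g \<in> J" if "f \<in> J" "g \<in> J" for f g
      using diff[OF that(1) neg[OF that(2)]] by simp
    show "subgroup J (add_monoid (free_algebra n))"
    proof (rule subgroup.intro)
      show "inv\<^bsub>add_monoid (free_algebra n)\<^esub> f \<in> J" if "f \<in> J" for f
        using inv[OF that] neg[OF that] unfolding a_inv_def by metis
    qed (use sub \<open>0 \<in> J\<close> add in simp_all)
  qed (simp_all add: assms(5,6))
  show "quantum_relations n p \<subseteq> J"
    using rel by (auto simp: quantum_relations_eq)
qed

lemma (in scalar_embedding) eval_quantum_rel:
  "eval c (quantum_rel p i j) = c i * c j - \<iota> (p $$ (i, j)) * (c j * c i)"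
  by (simp add: quantum_rel_def eval_simps)

lemma quantum_rel_closed:
  "\<lbrakk>i < n; j < n\<rbrakk> \<Longrightarrow> quantum_rel p i j \<in> carrier (free_algebra n)"
  unfolding quantum_rel_def by (intro free_algebra_closed)

text \<open>The polynomials killed by \<open>eval c\<close> form a two-sided ideal, which contains
  the defining relations because \<open>c\<close> is a solution.\<close>

lemma (in scalar_embedding) eval_quantum_ideal:
  assumes "quantum_tuple n p c" "f \<in> quantum_ideal n p"
  shows "eval c f = 0"
proof -
  have "quantum_ideal n p \<subseteq> {f \<in> carrier (free_algebra n). eval c f = 0}"
  proof (rule quantum_ideal_minimal, goal_cases)
    case (1 i j)
    then have "c i * c j = \<iota> (p $$ (i, j)) * (c j * c i)"
      using assms(1) unfolding quantum_tuple_def by blast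
    then show ?case using 1 quantum_rel_closed[of i n j p]
      by (simp add: eval_quantum_rel)
  next
    case (4 f g)
    then show ?case using free_algebra_closed(4)[of f n g] by (simp add: eval_simps)
  next
    case (5 f g)
    then show ?case using free_algebra_closed(5)[of g n f] by (simp add: eval_simps)
  next
    case (6 f g)
    then show ?case using free_algebra_closed(5)[of f n g] by (simp add: eval_simps)
  qed (auto simp: eval_simps)
  then show ?thesis using assms(2) by blast
qed

text \<open>The preimage of an ideal under a substitution is an ideal, so the generating relations
  are all that has to be tested.\<close>

lemma free_eval_quantum_ideal:
  assumes F: "\<And>i. i < n \<Longrightarrow> F i \<in> carrier (free_algebra m)"
    and rel: "\<And>i j. \<lbrakk>i < n; j < n\<rbrakk> \<Longrightarrow> free.eval F (quantum_rel p i j) \<in> quantum_ideal m q"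
    and f: "f \<in> quantum_ideal n p"
  shows "free.eval F f \<in> quantum_ideal m q"
proof -
  interpret ideal "quantum_ideal m q" "free_algebra m" by (rule ideal_quantum_relations)
  have diff: "f - g \<in> quantum_ideal m q" if "f \<in> quantum_ideal m q" "g \<in> quantum_ideal m q" for f g
    using additive_subgroup.a_inv_closed[OF is_additive_subgroup that(2)] free_algebra_a_minus[of f m g]
      additive_subgroup.a_closed[OF is_additive_subgroup that(1)] quantum_ideal_carrier that
    by (metis a_minus_def)
  have closed: "free.eval F f \<in> carrier (free_algebra m)" if "f \<in> carrier (free_algebra n)" for f
    using that F by (rule free_eval_closed)
  have "quantum_ideal n p \<subseteq> {f \<in> carrier (free_algebra n). free.eval F f \<in> quantum_ideal m q}"
  proof (rule quantum_ideal_minimal, goal_cases)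
    case (1 i j)
    then show ?case using rel quantum_rel_closed by blast
  next
    case 2
    then show ?case by blast
  next
    case 3
    then show ?case using additive_subgroup.zero_closed[OF is_additive_subgroup]
      by (simp add: free.eval_simps)
  next
    case (4 f g)
    then show ?case using diff free_algebra_closed(4)[of f n g] by (simp add: free.eval_simps)
  next
    case (5 f g)
    then show ?case using I_l_closed[of "free.eval F f" "free.eval F g"] closed[of g]
        free_algebra_closed(5)[of g n f]
      by (simp add: free.eval_simps)
  next
    case (6 f g)
    then show ?case using I_r_closed[of "free.eval F f" "free.eval F g"] closed[of g]
        free_algebra_closed(5)[of f n g]
      by (simp add: free.eval_simps)
  qed
  then show ?thesis using f by blast
qed

section \<open>Isomorphisms and tuples\<close>

text \<open>Projecting and then applying \<open>h\<close>, and substituting \<open>F\<close> and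
  then projecting, are homomorphisms on the free algebra that agree on the generators. Thus
  substitution of \<open>F\<close> lifts \<open>h\<close>.\<close>

lemma algebra_iso_quantum_proj:
  assumes h: "h \<in> algebra_iso (quantum_affine_space n p) (quantum_affine_space m q)"
    and F: "\<And>i. i < n \<Longrightarrow> F i \<in> carrier (free_algebra m)"
    and hF: "\<And>i. i < n \<Longrightarrow> h (quantum_proj n p (gen i)) = quantum_proj m q (F i)"
    and f: "f \<in> carrier (free_algebra n)"
  shows "h (quantum_proj n p f) = quantum_proj m q (free.eval F f)"
proof -
  have hom: "h \<in> Ring.ring_hom (quantum_affine_space n p) (quantum_affine_space m q)"
    and smult: "\<And>c x. x \<in> carrier (quantum_affine_space n p) \<Longrightarrow>
      h (c \<odot>\<^bsub>quantum_affine_space n p\<^esub> x) = c \<odot>\<^bsub>quantum_affine_space m q\<^esub> h x"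
    using h by (auto simp: algebra_iso_def ring_iso_def)
  note hom = ring_hom_memE[OF hom]
  have one: "(1 :: nat list \<Rightarrow>\<^sub>0 'a) \<in> carrier (free_algebra k)" for k
    by (simp add: zero_list_def)
  have proj_closed: "quantum_proj n p g \<in> carrier (quantum_affine_space n p)"
    if "g \<in> carrier (free_algebra n)" for g
    using that by (simp only: quantum_affine_space_carrier image_eqI)
  have closed: "free.eval F g \<in> carrier (free_algebra m)"
    if "g \<in> carrier (free_algebra n)" for g
    using that F by (rule free_eval_closed)
  show ?thesis using f
  proof (induction rule: free_algebra_induct)
    case (const a)
    \<comment> \<open>A constant is a scalar multiple of \<open>1\<close>, so linearity of
      \<open>h\<close> and preservation of \<open>1\<close> settle this case.\<close>
    have "h (quantum_proj n p (Poly_Mapping.single [] a * 1)) =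
        quantum_proj m q (Poly_Mapping.single [] a * 1)"
      by (simp only: quantum_proj_smult one smult proj_closed)
        (simp only: quantum_proj_one hom)
    then show ?case by (simp add: free.eval_const)
  next
    case (gen i)
    then show ?case by (simp add: hF free.eval_gen)
  next
    case (add f g)
    then show ?case
      by (simp only: quantum_proj_add hom proj_closed closed free.eval_add)
  next
    case (mult f g)
    then show ?case
      by (simp only: quantum_proj_mult hom proj_closed closed free.eval_mult)
  qed
qed

context scalar_embedding
begin

lemma eval_eq_of_quantum_proj_eq:
  assumes "quantum_tuple n p c" "quantum_proj n p f = quantum_proj n p g"
    and "f \<in> carrier (free_algebra n)" "g \<in> carrier (free_algebra n)"
  shows "eval c f = eval c g"
  using eval_quantum_ideal[of n p c "f - g"] assms by (simp add: quantum_proj_eq_iff eval_diff)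

text \<open>Contravariance: a solution \<open>c\<close> is a homomorphism out of the second space,
  and its composite with \<open>h\<close> is a homomorphism out of the first, with value
  \<open>eval c (F i)\<close> at the \<open>i\<close>-th generator.\<close>

lemma quantum_tuple_algebra_iso:
  assumes h: "h \<in> algebra_iso (quantum_affine_space n p) (quantum_affine_space m q)"
    and F: "\<And>i. i < n \<Longrightarrow> F i \<in> carrier (free_algebra m)"
    and hF: "\<And>i. i < n \<Longrightarrow> h (quantum_proj n p (gen i)) = quantum_proj m q (F i)"
    and c: "quantum_tuple m q c"
  shows "quantum_tuple n p (\<lambda>i. eval c (F i))"
  unfolding quantum_tuple_def
proof (intro allI impI)
  fix i j assume ij: "i < n" "j < n"
  let ?r = "quantum_rel p i j"
  note proj = algebra_iso_quantum_proj[OF h F hF]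
  have r: "?r \<in> carrier (free_algebra n)" using ij by (rule quantum_rel_closed)
  have zero: "(0 :: nat list \<Rightarrow>\<^sub>0 'k) \<in> carrier (free_algebra k)" for k by simp
  have "quantum_proj n p ?r = quantum_proj n p 0"
    using quantum_rel_in_ideal[OF ij, of p] r zero by (simp add: quantum_proj_eq_iff)
  then have "quantum_proj m q (free.eval F ?r) = quantum_proj m q (free.eval F 0)"
    using proj[OF _ _ r] proj[OF _ _ zero] by simp
  then have "eval c (free.eval F ?r) = eval c (free.eval F 0)"
    by (rule eval_eq_of_quantum_proj_eq[OF c])
      (use free_eval_closed[OF r F] free_eval_closed[OF zero F] in auto)
  then show "eval c (F i) * eval c (F j) = \<iota> (p $$ (i, j)) * (eval c (F j) * eval c (F i))"
    using eval_free_eval[OF r, of c F] by (simp add: free.eval_zero eval_zero eval_quantum_rel)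
qed

text \<open>Substituting \<open>F\<close> into \<open>f\<close> represents the class of
  \<open>gen a\<close>, and evaluation at a solution depends only on the class. Applied to lifts of
  the inverse images of the generators, this makes \<open>F\<close> and \<open>G\<close> act
  inversely on solutions.\<close>

lemma eval_algebra_iso_inverse:
  assumes h: "h \<in> algebra_iso (quantum_affine_space n p) (quantum_affine_space m q)"
    and F: "\<And>i. i < n \<Longrightarrow> F i \<in> carrier (free_algebra m)"
    and hF: "\<And>i. i < n \<Longrightarrow> h (quantum_proj n p (gen i)) = quantum_proj m q (F i)"
    and c: "quantum_tuple m q c"
    and a: "a < m" and f: "f \<in> carrier (free_algebra n)"
    and hf: "h (quantum_proj n p f) = quantum_proj m q (gen a)"
  shows "eval (\<lambda>i. eval c (F i)) f = c a"
proof -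
  have "quantum_proj m q (free.eval F f) = quantum_proj m q (gen a)"
    using algebra_iso_quantum_proj[OF h F hF f] hf by simp
  then have "eval c (free.eval F f) = eval c (gen a)"
    by (rule eval_eq_of_quantum_proj_eq[OF c _ free_eval_closed[OF f F] free_algebra_closed(2)[OF a]])
  then show ?thesis
    by (simp add: eval_free_eval[OF f] eval_gen)
qed

end

section \<open>Upper triangular three by three matrices with constant diagonal\<close>

text \<open>In a product, \<open>e12\<close> and \<open>e23\<close> each follow the Leibniz rule,
  while \<open>e13\<close> also receives \<open>e12 x * e23 y\<close>. So two tangent vectors are
  carried at once, and their product is recorded with its order.\<close>

datatype 'k heis = Heis (diag: 'k) (e12: 'k) (e23: 'k) (e13: 'k)

instantiation heis :: (comm_ring_1) ring_1
begin

definition "0 = Heis 0 0 0 0"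
definition "1 = Heis 1 0 0 0"
definition "x + y = Heis (diag x + diag y) (e12 x + e12 y) (e23 x + e23 y) (e13 x + e13 y)"
definition "x - y = Heis (diag x - diag y) (e12 x - e12 y) (e23 x - e23 y) (e13 x - e13 y)"
definition "- x = Heis (- diag x) (- e12 x) (- e23 x) (- e13 x)"
definition "x * y = Heis (diag x * diag y) (diag x * e12 y + e12 x * diag y)
  (diag x * e23 y + e23 x * diag y) (diag x * e13 y + e12 x * e23 y + e13 x * diag y)"

instance
  by standard
    (auto simp: zero_heis_def one_heis_def plus_heis_def minus_heis_def uminus_heis_def
      times_heis_def algebra_simps)

end

interpretation heis: scalar_embedding "\<lambda>a::'k::field. Heis a 0 0 0"
  by standard (simp_all add: one_heis_def plus_heis_def times_heis_def mult.commute)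

text \<open>Entrywise these are the equations of the base point, their linearisations along
  \<open>u\<close> and \<open>v\<close>, and a second-order equation. At \<open>a = 0\<close> only
  \<open>u i * v j = p $$ (i, j) * (u j * v i)\<close> remains.\<close>

lemma heis_quantum_tuple_iff:
  "heis.quantum_tuple n p (\<lambda>i. Heis (a i) (u i) (v i) (w i)) \<longleftrightarrow>
   (\<forall>i<n. \<forall>j<n. a i * a j = p $$ (i, j) * (a j * a i) \<and>
     a i * u j + u i * a j = p $$ (i, j) * (a j * u i + u j * a i) \<and>
     a i * v j + v i * a j = p $$ (i, j) * (a j * v i + v j * a i) \<and>
     a i * w j + u i * v j + w i * a j = p $$ (i, j) * (a j * w i + u j * v i + w j * a i))"
  by (simp add: heis.quantum_tuple_def times_heis_def)

text \<open>One row \<open>D\<close> serves both directions since \<open>e12\<close> and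
  \<open>e23\<close> obey the same product rule. Besides \<open>D\<close> applied to
  \<open>w\<close>, the corner entry contains second-order terms in \<open>u\<close> and
  \<open>v\<close>, hence the existential \<open>z\<close>.\<close>

definition has_jacobian ::
    "nat \<Rightarrow> (nat \<Rightarrow> 'k::field) \<Rightarrow> (nat list \<Rightarrow>\<^sub>0 'k) \<Rightarrow> 'k \<Rightarrow> (nat \<Rightarrow> 'k) \<Rightarrow> bool" where
  "has_jacobian m a f d D \<longleftrightarrow>
    (\<forall>u v w. \<exists>z. heis.eval (\<lambda>j. Heis (a j) (u j) (v j) (w j)) f =
      Heis d (\<Sum>j<m. D j * u j) (\<Sum>j<m. D j * v j) z)"

lemma has_jacobianE:
  assumes "has_jacobian m a f d D"
  obtains z where "heis.eval (\<lambda>j. Heis (a j) (u j) (v j) (w j)) f =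
    Heis d (\<Sum>j<m. D j * u j) (\<Sum>j<m. D j * v j) z"
  using assms unfolding has_jacobian_def by blast

lemma has_jacobian_add:
  assumes "has_jacobian m a f d D" "has_jacobian m a g d' D'"
  shows "has_jacobian m a (f + g) (d + d') (\<lambda>j. D j + D' j)"
  unfolding has_jacobian_def
proof (intro allI)
  fix u v w
  obtain z where "heis.eval (\<lambda>j. Heis (a j) (u j) (v j) (w j)) f =
    Heis d (\<Sum>j<m. D j * u j) (\<Sum>j<m. D j * v j) z"
    using has_jacobianE[OF assms(1)] .
  moreover obtain z' where "heis.eval (\<lambda>j. Heis (a j) (u j) (v j) (w j)) g =
    Heis d' (\<Sum>j<m. D' j * u j) (\<Sum>j<m. D' j * v j) z'"
    using has_jacobianE[OF assms(2)] .
  ultimately show "\<exists>z. heis.eval (\<lambda>j. Heis (a j) (u j) (v j) (w j)) (f + g) =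
      Heis (d + d') (\<Sum>j<m. (D j + D' j) * u j) (\<Sum>j<m. (D j + D' j) * v j) z"
    by (simp add: heis.eval_add plus_heis_def sum.distrib distrib_right)
qed

text \<open>This is the Leibniz rule, read off from the \<open>e12\<close> and \<open>e23\<close>
  entries of the product.\<close>

lemma has_jacobian_mult:
  assumes "has_jacobian m a f d D" "has_jacobian m a g d' D'"
  shows "has_jacobian m a (f * g) (d * d') (\<lambda>j. d * D' j + D j * d')"
  unfolding has_jacobian_def
proof (intro allI)
  fix u v w
  obtain z where "heis.eval (\<lambda>j. Heis (a j) (u j) (v j) (w j)) f =
    Heis d (\<Sum>j<m. D j * u j) (\<Sum>j<m. D j * v j) z"
    using has_jacobianE[OF assms(1)] .
  moreover obtain z' where "heis.eval (\<lambda>j. Heis (a j) (u j) (v j) (w j)) g =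
    Heis d' (\<Sum>j<m. D' j * u j) (\<Sum>j<m. D' j * v j) z'"
    using has_jacobianE[OF assms(2)] .
  moreover have "(\<Sum>j<m. (d * D' j + D j * d') * x j) =
      d * (\<Sum>j<m. D' j * x j) + (\<Sum>j<m. D j * x j) * d'" for x
    by (simp add: sum_distrib_left sum_distrib_right algebra_simps sum.distrib)
  ultimately show "\<exists>z. heis.eval (\<lambda>j. Heis (a j) (u j) (v j) (w j)) (f * g) =
      Heis (d * d') (\<Sum>j<m. (d * D' j + D j * d') * u j) (\<Sum>j<m. (d * D' j + D j * d') * v j) z"
    by (simp add: heis.eval_mult times_heis_def)
qed

lemma has_jacobian_exists:
  assumes "f \<in> carrier (free_algebra m)"
  shows "\<exists>d D. has_jacobian m a f d D"
  using assms
proof (induction rule: free_algebra_induct)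
  case (const b)
  have "has_jacobian m a (Poly_Mapping.single [] b) b (\<lambda>_. 0)"
    by (simp add: has_jacobian_def heis.eval_const)
  then show ?case by blast
next
  case (gen i)
  then have "has_jacobian m a (gen i) (a i) (\<lambda>j. if j = i then 1 else 0)"
    by (simp add: has_jacobian_def heis.eval_gen if_distrib[of "\<lambda>x. x * _"] sum.delta cong: if_cong)
  then show ?case by blast
next
  case (add f g)
  then show ?case using has_jacobian_add by blast
next
  case (mult f g)
  then show ?case using has_jacobian_mult by blast
qed

section \<open>Changes of coordinates\<close>

text \<open>What an isomorphism leaves behind on solutions in \<open>heis\<close>: mutually inverse
  polynomial maps. The axioms are symmetric in the two sides, so each result also holds with the
  roles exchanged.\<close>

locale quantum_coordinate_change =
  fixes n m :: nat and p q :: "'k::field mat" and F G :: "nat \<Rightarrow> nat list \<Rightarrow>\<^sub>0 'k"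
  assumes F_closed: "\<And>i. i < n \<Longrightarrow> F i \<in> carrier (free_algebra m)"
    and G_closed: "\<And>a. a < m \<Longrightarrow> G a \<in> carrier (free_algebra n)"
    and F_tuple: "\<And>c. heis.quantum_tuple m q c \<Longrightarrow> heis.quantum_tuple n p (\<lambda>i. heis.eval c (F i))"
    and G_tuple: "\<And>c. heis.quantum_tuple n p c \<Longrightarrow> heis.quantum_tuple m q (\<lambda>a. heis.eval c (G a))"
    and GF: "\<And>c a. \<lbrakk>heis.quantum_tuple m q c; a < m\<rbrakk> \<Longrightarrow>
      heis.eval (\<lambda>i. heis.eval c (F i)) (G a) = c a"
    and FG: "\<And>c i. \<lbrakk>heis.quantum_tuple n p c; i < n\<rbrakk> \<Longrightarrow>
      heis.eval (\<lambda>a. heis.eval c (G a)) (F i) = c i"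
begin

text \<open>
  $D$ and $E$ are the Jacobians of \<open>F\<close> and \<open>G\<close> at the scalar points $\alpha = G(0)$ and $0$.
\<close>
lemma jacobians:
  obtains \<alpha> :: "nat \<Rightarrow> 'k" and D E :: "nat \<Rightarrow> nat \<Rightarrow> 'k"
  where "\<And>u. \<exists>w. heis.quantum_tuple m q (\<lambda>a. Heis (\<alpha> a) (\<Sum>j<n. E a j * u j) 0 (w a))"
    and "\<And>u v i. i < n \<Longrightarrow> \<exists>z. heis.eval (\<lambda>a. Heis (\<alpha> a) (u a) (v a) 0) (F i) =
      Heis 0 (\<Sum>a<m. D i a * u a) (\<Sum>a<m. D i a * v a) z"
    and "\<And>i k. \<lbrakk>i < n; k < n\<rbrakk> \<Longrightarrow> (\<Sum>a<m. D i a * E a k) = (if i = k then 1 else 0)"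
proof -
  have "\<exists>d D. a < m \<longrightarrow> has_jacobian n (\<lambda>_. 0) (G a) d D" for a
    using has_jacobian_exists[OF G_closed] by blast
  then obtain \<alpha> E where \<alpha>E: "\<And>a. a < m \<Longrightarrow> has_jacobian n (\<lambda>_. 0) (G a) (\<alpha> a) (E a)"
    by metis
  have "\<exists>d D. i < n \<longrightarrow> has_jacobian m \<alpha> (F i) d D" for i
    using has_jacobian_exists[OF F_closed] by blast
  then obtain d D where dD: "\<And>i. i < n \<Longrightarrow> has_jacobian m \<alpha> (F i) (d i) (D i)"
    by metis
  \<comment> \<open>With only \<open>e12\<close> entries all products vanish, so \<open>c u\<close>
    is a solution for every \<open>u\<close>, whatever \<open>p\<close> is: this is a tangent vector
    at the point \<open>0\<close>.\<close>
  define c :: "(nat \<Rightarrow> 'k) \<Rightarrow> nat \<Rightarrow> 'k heis" where "c u j = Heis 0 (u j) 0 0" for u j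
  define w where "w u a = e13 (heis.eval (c u) (G a))" for u a
  let ?e = "\<lambda>u a. Heis (\<alpha> a) (\<Sum>j<n. E a j * u j) 0 (w u a)"
  have c: "heis.quantum_tuple n p (c u)" for u
    unfolding c_def heis_quantum_tuple_iff by simp
  have w: "heis.eval (c u) (G a) = ?e u a" if a: "a < m" for u a
  proof -
    obtain z where "heis.eval (c u) (G a) = Heis (\<alpha> a) (\<Sum>j<n. E a j * u j) (\<Sum>j<n. E a j * 0) z"
      unfolding c_def by (rule has_jacobianE[OF \<alpha>E[OF a], of u "\<lambda>_. 0" "\<lambda>_. 0"])
    then show ?thesis by (simp add: w_def)
  qed
  have e_tuple: "heis.quantum_tuple m q (?e u)" for u
    using G_tuple[OF c] heis.quantum_tuple_cong[of m "\<lambda>a. heis.eval (c u) (G a)" "?e u" q, OF w]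
    by simp
  have e_eval: "heis.eval (?e u) (F i) = c u i" if "i < n" for u i
    using FG[OF c that] heis.eval_cong[OF F_closed[OF that] w] by simp
  \<comment> \<open>Chain rule: comparing the diagonal and \<open>e12\<close> entries of the
    identity F(G(c u)) = c u shows that \<open>F\<close> vanishes at \<open>\<alpha>\<close> and
    that \<open>D\<close> composed with \<open>E\<close> is the identity.\<close>
  have E_u: "d i = 0 \<and> (\<Sum>a<m. D i a * (\<Sum>j<n. E a j * u j)) = u i" if i: "i < n" for i u
  proof -
    obtain z where "heis.eval (?e u) (F i) =
        Heis (d i) (\<Sum>a<m. D i a * (\<Sum>j<n. E a j * u j)) (\<Sum>a<m. D i a * 0) z"
      by (rule has_jacobianE[OF dD[OF i], of "\<lambda>a. \<Sum>j<n. E a j * u j" "\<lambda>_. 0" "w u"])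
    then show ?thesis using e_eval[OF i] by (simp add: c_def)
  qed
  show ?thesis
  proof (rule that[of \<alpha> E D])
    show "\<exists>w. heis.quantum_tuple m q (\<lambda>a. Heis (\<alpha> a) (\<Sum>j<n. E a j * u j) 0 (w a))" for u
      using e_tuple by (intro exI[of _ "w u"])
    show "\<exists>z. heis.eval (\<lambda>a. Heis (\<alpha> a) (u a) (v a) 0) (F i) =
        Heis 0 (\<Sum>a<m. D i a * u a) (\<Sum>a<m. D i a * v a) z" if "i < n" for u v i
      using dD[OF that] E_u[OF that] by (simp add: has_jacobian_def)
    show "(\<Sum>a<m. D i a * E a k) = (if i = k then 1 else 0)" if "i < n" "k < n" for i k
      using E_u[OF that(1), of "\<lambda>j. if j = k then 1 else 0"] that(2)
      by (simp add: if_distrib[of "\<lambda>x. _ * x"] sum.delta cong: if_cong)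
  qed
qed

end

lemma (in quantum_coordinate_change) swap: "quantum_coordinate_change m n q p G F"
  by unfold_locales (fact F_closed G_closed F_tuple G_tuple GF FG)+

section \<open>Permutations from invertible matrices\<close>

text \<open>If \<open>m < n\<close>, zero columns for \<open>D\<close> and zero rows for
  \<open>E\<close> make both matrices square. The right inverse is then a left inverse too, but the
  product in the other order has a zero at position \<open>(m, m)\<close>.\<close>

lemma right_inverse_dim_le:
  fixes D E :: "nat \<Rightarrow> nat \<Rightarrow> 'k::field"
  assumes DE: "\<And>i k. \<lbrakk>i < n; k < n\<rbrakk> \<Longrightarrow> (\<Sum>a<m. D i a * E a k) = (if i = k then 1 else 0)"
  shows "n \<le> m"
proof (rule ccontr)
  assume "\<not> n \<le> m"
  define D' where "D' = mat n n (\<lambda>(i, a). if a < m then D i a else 0)"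
  define E' where "E' = mat n n (\<lambda>(a, k). if a < m then E a k else 0)"
  have "D' * E' = 1\<^sub>m n"
  proof (rule eq_matI)
    fix i k assume ik: "i < dim_row (1\<^sub>m n :: 'k mat)" "k < dim_col (1\<^sub>m n :: 'k mat)"
    have "(D' * E') $$ (i, k) = (\<Sum>a\<in>{0..<n}. if a < m then D i a * E a k else 0)"
      using ik by (auto simp: D'_def E'_def scalar_prod_def intro!: sum.cong)
    also have "\<dots> = (\<Sum>a<m. D i a * E a k)"
      using \<open>\<not> n \<le> m\<close> by (intro sum.mono_neutral_cong_right) auto
    finally show "(D' * E') $$ (i, k) = 1\<^sub>m n $$ (i, k)"
      using DE ik by simp
  qed (simp_all add: D'_def E'_def)
  then have "E' * D' = 1\<^sub>m n"
    by (rule mat_mult_left_right_inverse[rotated 2]) (simp_all add: D'_def E'_def)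
  moreover have "(E' * D') $$ (m, m) = 0"
    using \<open>\<not> n \<le> m\<close> by (auto simp: D'_def E'_def scalar_prod_def intro!: sum.neutral)
  ultimately show False using \<open>\<not> n \<le> m\<close> by simp
qed

text \<open>Over a field a one-sided inverse of a square matrix is two-sided. The permutation comes
  from a nonzero summand in the Leibniz expansion of the nonzero determinant.\<close>

lemma right_inverse_square:
  fixes D E :: "nat \<Rightarrow> nat \<Rightarrow> 'k::field"
  assumes DE: "\<And>i k. \<lbrakk>i < n; k < n\<rbrakk> \<Longrightarrow> (\<Sum>a<n. D i a * E a k) = (if i = k then 1 else 0)"
  shows "\<And>a b. \<lbrakk>a < n; b < n\<rbrakk> \<Longrightarrow> (\<Sum>i<n. E a i * D i b) = (if a = b then 1 else 0)"
    and "\<exists>\<sigma>. \<sigma> permutes {..<n} \<and> (\<forall>i<n. D i (\<sigma> i) \<noteq> 0)"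
proof -
  define D' where "D' = mat n n (\<lambda>(i, a). D i a)"
  define E' where "E' = mat n n (\<lambda>(a, k). E a k)"
  have D': "D' \<in> carrier_mat n n" and E': "E' \<in> carrier_mat n n"
    by (simp_all add: D'_def E'_def)
  have DE': "D' * E' = 1\<^sub>m n"
    using DE by (intro eq_matI) (simp_all add: D'_def E'_def scalar_prod_def atLeast0LessThan)
  have ED': "E' * D' = 1\<^sub>m n"
    using D' E' DE' by (rule mat_mult_left_right_inverse)
  show "(\<Sum>i<n. E a i * D i b) = (if a = b then 1 else 0)" if "a < n" "b < n" for a b
    using arg_cong[OF ED', of "\<lambda>M. M $$ (a, b)"] that
    by (simp add: D'_def E'_def scalar_prod_def atLeast0LessThan)
  have "det D' * det E' = 1"
    using det_mult[OF D' E'] DE' by simp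
  then have "det D' \<noteq> 0" by auto
  then obtain \<sigma> where \<sigma>: "\<sigma> permutes {0..<n}" "signof \<sigma> * (\<Prod>i = 0..<n. D' $$ (i, \<sigma> i)) \<noteq> 0"
    unfolding det_def'[OF D'] using sum.not_neutral_contains_not_neutral by (metis (no_types, lifting) mem_Collect_eq)
  have "D i (\<sigma> i) \<noteq> 0" if "i < n" for i
  proof -
    have "D' $$ (i, \<sigma> i) \<noteq> 0" using \<sigma>(2) that by auto
    then show ?thesis using that permutes_in_image[OF \<sigma>(1), of i] by (simp add: D'_def)
  qed
  then show "\<exists>\<sigma>. \<sigma> permutes {..<n} \<and> (\<forall>i<n. D i (\<sigma> i) \<noteq> 0)"
    using \<sigma>(1) by (auto simp: atLeast0LessThan)
qed

text \<open>The hypotheses \<open>square\<close> and \<open>mixed\<close> say that \<open>D\<close>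
  carries two kinds of solution pairs for \<open>q\<close> to solution pairs for \<open>p\<close>:
  the pair (e_a, e_a), and the pair of e_a + e_b and e_a + q_ab e_b.\<close>

lemma is_mat_permutation_of_quadratic_relations:
  fixes p q :: "'k::field mat" and D E :: "nat \<Rightarrow> nat \<Rightarrow> 'k"
  assumes q: "q \<in> mult_antisym_mat n" and p: "p \<in> mult_antisym_mat n"
    and DE: "\<And>i k. \<lbrakk>i < n; k < n\<rbrakk> \<Longrightarrow> (\<Sum>a<n. D i a * E a k) = (if i = k then 1 else 0)"
    and square: "\<And>i j a. \<lbrakk>i < n; j < n; a < n\<rbrakk> \<Longrightarrow> D i a * D j a = p $$ (i, j) * (D j a * D i a)"
    and mixed: "\<And>i j a b. \<lbrakk>i < n; j < n; a < n; b < n; a \<noteq> b\<rbrakk> \<Longrightarrow>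
      (D i a + D i b) * (D j a + q $$ (a, b) * D j b) =
      p $$ (i, j) * ((D j a + D j b) * (D i a + q $$ (a, b) * D i b))"
  shows "is_mat_permutation n p q"
proof -
  have ED: "(\<Sum>i<n. E a i * D i b) = (if a = b then 1 else 0)" if "a < n" "b < n" for a b
    using DE that by (rule right_inverse_square(1))
  \<comment> \<open>Removing the two \<open>square\<close> relations from \<open>mixed\<close>
    leaves the terms that involve both columns.\<close>
  have cross: "q $$ (a, b) * (D i a * D j b) + D i b * D j a =
      p $$ (i, j) * (q $$ (a, b) * (D j a * D i b) + D j b * D i a)"
    if "i < n" "j < n" "a < n" "b < n" "a \<noteq> b" for i j a b
  proof -
    let ?q = "q $$ (a, b)" and ?p = "p $$ (i, j)"
    have "?q * (D i a * D j b) + D i b * D j a =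
        (D i a + D i b) * (D j a + ?q * D j b) - D i a * D j a - ?q * (D i b * D j b)"
      by (simp add: algebra_simps)
    also have "\<dots> = ?p * ((D j a + D j b) * (D i a + ?q * D i b)) - ?p * (D j a * D i a) -
        ?q * (?p * (D j b * D i b))"
      by (simp only: mixed[OF that] square[OF that(1,2,3)] square[OF that(1,2,4)])
    also have "\<dots> = ?p * (?q * (D j a * D i b) + D j b * D i a)"
      by (simp add: algebra_simps)
    finally show ?thesis .
  qed
  have row: "q $$ (a, b) = 1"
    if "i < n" "a < n" "b < n" "a \<noteq> b" and nz: "D i a \<noteq> 0" "D i b \<noteq> 0" for i a b
  proof (rule ccontr)
    assume q1: "q $$ (a, b) \<noteq> 1"
    \<comment> \<open>The minors of columns \<open>a\<close> and \<open>b\<close> that involve row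
      \<open>i\<close> vanish: if p_ij = 1, \<open>cross\<close> becomes (q_ab - 1) times the minor;
      otherwise \<open>square\<close> forces both entries of row \<open>j\<close> to be
      zero.\<close>
    have minor: "D i a * D j b = D i b * D j a" if "j < n" for j
    proof (cases "p $$ (i, j) = 1")
      case True
      have "(q $$ (a, b) - 1) * (D i a * D j b - D i b * D j a) = 0"
        using cross[OF \<open>i < n\<close> that \<open>a < n\<close> \<open>b < n\<close> \<open>a \<noteq> b\<close>] True by (simp add: algebra_simps)
      then show ?thesis using q1 by simp
    next
      case False
      then have "D j a = 0" "D j b = 0"
        using square[OF \<open>i < n\<close> that \<open>a < n\<close>] square[OF \<open>i < n\<close> that \<open>b < n\<close>] nz by auto
      then show ?thesis by simp
    qed
    \<comment> \<open>The minors make column \<open>a\<close> a multiple of column \<open>b\<close>,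
      and row \<open>b\<close> of the left inverse \<open>E\<close> tells these columns
      apart.\<close>
    have "D i a = D i a * (\<Sum>j<n. E b j * D j b)"
      using ED[OF \<open>b < n\<close> \<open>b < n\<close>] by simp
    also have "\<dots> = D i b * (\<Sum>j<n. E b j * D j a)"
      unfolding sum_distrib_left mult.left_commute[of _ "E b _"] using minor by simp
    also have "\<dots> = 0"
      using ED[OF \<open>b < n\<close> \<open>a < n\<close>] \<open>a \<noteq> b\<close> by simp
    finally show False using nz by simp
  qed
  obtain \<sigma> where \<sigma>: "\<sigma> permutes {..<n}" and nz: "\<And>i. i < n \<Longrightarrow> D i (\<sigma> i) \<noteq> 0"
    using right_inverse_square(2)[OF DE] by blast
  have \<sigma>_lt: "\<sigma> i < n" if "i < n" for i
    using permutes_in_image[OF \<sigma>, of i] that by simp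
  have "p $$ (i, j) = q $$ (\<sigma> i, \<sigma> j)" if ij: "i < n" "j < n" for i j
  proof (cases "i = j")
    case True
    then show ?thesis using p q ij \<sigma>_lt by (simp add: mult_antisym_mat_def)
  next
    case False
    then have ne: "\<sigma> i \<noteq> \<sigma> j" using permutes_inj[OF \<sigma>] by (auto dest: injD)
    show ?thesis
    \<comment> \<open>If the crossed product vanishes, \<open>cross\<close> reduces to the
      difference of the two parameters times a nonzero product. If not, \<open>square\<close> and
      \<open>row\<close> force both parameters to be \<open>1\<close>.\<close>
    proof (cases "D i (\<sigma> j) * D j (\<sigma> i) = 0")
      case True
      have "(q $$ (\<sigma> i, \<sigma> j) - p $$ (i, j)) * (D i (\<sigma> i) * D j (\<sigma> j)) = 0"
        using cross[OF ij \<sigma>_lt[OF ij(1)] \<sigma>_lt[OF ij(2)] ne] True by (auto simp: algebra_simps)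
      then show ?thesis using nz ij by simp
    next
      case False
      then have "p $$ (i, j) = 1"
        using square[OF ij \<sigma>_lt[OF ij(1)]] nz[OF ij(1)] by auto
      moreover have "q $$ (\<sigma> i, \<sigma> j) = 1"
        using row[OF ij(1) \<sigma>_lt[OF ij(1)] \<sigma>_lt[OF ij(2)] ne] nz[OF ij(1)] False by simp
      ultimately show ?thesis by simp
    qed
  qed
  then show ?thesis using \<sigma> unfolding is_mat_permutation_def by blast
qed

section \<open>Isomorphisms of quantum affine spaces\<close>

lemma (in quantum_coordinate_change) dim_le: "n \<le> m"
  by (rule jacobians) (rule right_inverse_dim_le)

lemma (in quantum_coordinate_change) dim_eq: "m = n"
  using dim_le quantum_coordinate_change.dim_le[OF swap] by simp

lemma (in quantum_coordinate_change) is_mat_permutation: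
  assumes p: "p \<in> mult_antisym_mat n" and q: "q \<in> mult_antisym_mat m"
  shows "is_mat_permutation n p q"
proof (rule jacobians)
  fix \<alpha> :: "nat \<Rightarrow> 'k" and D E :: "nat \<Rightarrow> nat \<Rightarrow> 'k"
  assume E_tuple: "\<And>u. \<exists>w. heis.quantum_tuple m q (\<lambda>a. Heis (\<alpha> a) (\<Sum>j<n. E a j * u j) 0 (w a))"
    and F_eval: "\<And>u v i. i < n \<Longrightarrow> \<exists>z. heis.eval (\<lambda>a. Heis (\<alpha> a) (u a) (v a) 0) (F i) =
      Heis 0 (\<Sum>a<m. D i a * u a) (\<Sum>a<m. D i a * v a) z"
    and DE: "\<And>i k. \<lbrakk>i < n; k < n\<rbrakk> \<Longrightarrow> (\<Sum>a<m. D i a * E a k) = (if i = k then 1 else 0)"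
  note mn = dim_eq
  have qn: "q \<in> mult_antisym_mat n" using q mn by simp
  have q1: "q $$ (a, a) = 1" if "a < n" for a
    using qn that unfolding mult_antisym_mat_def by blast
  have q_inv: "q $$ (b, a) * q $$ (a, b) = 1" if "a < n" "b < n" "a \<noteq> b" for a b
  proof -
    have "q $$ (b, a) = inverse (q $$ (a, b))" "q $$ (a, b) \<noteq> 0"
      using qn that unfolding mult_antisym_mat_def by blast+
    then show ?thesis by simp
  qed
  have ED: "(\<Sum>i<n. E a i * D i b) = (if a = b then 1 else 0)" if "a < n" "b < n" for a b
    using DE[unfolded mn] that by (rule right_inverse_square(1))
  \<comment> \<open>Any \<open>u\<close> is a tangent vector at \<open>\<alpha>\<close>: it is the
    image under \<open>E\<close> of \<open>u'\<close>, the image of \<open>u\<close> under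
    \<open>D\<close>, and \<open>E_tuple\<close> supplies a solution in that direction.\<close>
  have \<alpha>_u: "\<alpha> a * u b + u a * \<alpha> b = q $$ (a, b) * (\<alpha> b * u a + u b * \<alpha> a)" and
    \<alpha>_\<alpha>: "\<alpha> a * \<alpha> b = q $$ (a, b) * (\<alpha> b * \<alpha> a)" if ab: "a < n" "b < n" for a b u
  proof -
    define u' where "u' j = (\<Sum>c<n. D j c * u c)" for j
    have u': "(\<Sum>j<n. E c j * u' j) = u c" if "c < n" for c
    proof -
      have "(\<Sum>j<n. E c j * u' j) = (\<Sum>b<n. (\<Sum>j<n. E c j * D j b) * u b)"
        unfolding u'_def sum_distrib_left sum_distrib_right
        by (subst sum.swap) (simp add: mult.assoc)
      also have "\<dots> = (\<Sum>b<n. if b = c then u b else 0)"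
        using ED[OF that] by (intro sum.cong) auto
      finally show ?thesis using that by simp
    qed
    obtain w where "heis.quantum_tuple n q (\<lambda>a. Heis (\<alpha> a) (\<Sum>j<n. E a j * u' j) 0 (w a))"
      using E_tuple[unfolded mn] by (rule exE)
    note tuple = this[unfolded heis_quantum_tuple_iff, rule_format, OF ab, unfolded u'[OF ab(1)] u'[OF ab(2)]]
    show "\<alpha> a * u b + u a * \<alpha> b = q $$ (a, b) * (\<alpha> b * u a + u b * \<alpha> a)"
      and "\<alpha> a * \<alpha> b = q $$ (a, b) * (\<alpha> b * \<alpha> a)"
      using tuple by blast+
  qed
  have D_pair: "(\<Sum>a<n. D i a * u a) * (\<Sum>a<n. D j a * v a) =
      p $$ (i, j) * ((\<Sum>a<n. D j a * u a) * (\<Sum>a<n. D i a * v a))"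
    if uv: "\<And>a b. \<lbrakk>a < n; b < n\<rbrakk> \<Longrightarrow> u a * v b = q $$ (a, b) * (u b * v a)"
      and ij: "i < n" "j < n" for u v i j
  proof -
    \<comment> \<open>The linearised equations at \<open>\<alpha>\<close> hold for both
      \<open>u\<close> and \<open>v\<close> by \<open>\<alpha>_u\<close>. With corner entries
      \<open>0\<close>, the corner equation is exactly the hypothesis \<open>uv\<close>.\<close>
    have "heis.quantum_tuple m q (\<lambda>a. Heis (\<alpha> a) (u a) (v a) 0)"
      unfolding heis_quantum_tuple_iff mn
    proof (intro allI impI conjI)
      fix a b assume ab: "a < n" "b < n"
      show "\<alpha> a * \<alpha> b = q $$ (a, b) * (\<alpha> b * \<alpha> a)"
        by (rule \<alpha>_\<alpha>[OF ab])
      show "\<alpha> a * u b + u a * \<alpha> b = q $$ (a, b) * (\<alpha> b * u a + u b * \<alpha> a)"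
        by (rule \<alpha>_u[OF ab])
      show "\<alpha> a * v b + v a * \<alpha> b = q $$ (a, b) * (\<alpha> b * v a + v b * \<alpha> a)"
        by (rule \<alpha>_u[OF ab])
      show "\<alpha> a * 0 + u a * v b + 0 * \<alpha> b = q $$ (a, b) * (\<alpha> b * 0 + u b * v a + 0 * \<alpha> a)"
        using uv[OF ab] by (simp only: mult_zero_left mult_zero_right add_0_left add_0_right)
    qed
    note tuple = F_tuple[OF this]
    \<comment> \<open>The images under \<open>F\<close> have diagonal \<open>0\<close>, so
      \<open>z\<close> and \<open>z'\<close> drop out of their products and the corner equation for
      \<open>p\<close> is the claim.\<close>
    obtain z z' where
      "heis.eval (\<lambda>a. Heis (\<alpha> a) (u a) (v a) 0) (F i) =
        Heis 0 (\<Sum>a<n. D i a * u a) (\<Sum>a<n. D i a * v a) z"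
      "heis.eval (\<lambda>a. Heis (\<alpha> a) (u a) (v a) 0) (F j) =
        Heis 0 (\<Sum>a<n. D j a * u a) (\<Sum>a<n. D j a * v a) z'"
      using F_eval[of i u v] F_eval[of j u v] ij mn by auto
    then show ?thesis
      using tuple[unfolded heis.quantum_tuple_def, rule_format, OF ij]
      by (simp only: times_heis_def heis.sel heis.inject mult_zero_left mult_zero_right
          add_0_left add_0_right)
  qed
  have delta: "(\<Sum>c<n. D i c * (if c = a then x else 0)) = D i a * x" if "a < n" for i a x
    using that by (simp add: if_distrib[of "\<lambda>x. _ * x"] sum.delta cong: if_cong)
  show ?thesis
  proof (rule is_mat_permutation_of_quadratic_relations[OF qn p DE[unfolded mn]])
    fix i j a assume ija: "i < n" "j < n" "a < n"
    let ?u = "\<lambda>c. if c = a then 1 else 0 :: 'k"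
    have "?u c * ?u d = q $$ (c, d) * (?u d * ?u c)" if "c < n" "d < n" for c d
      using q1[OF \<open>a < n\<close>] by simp
    from D_pair[of ?u ?u, OF this ija(1,2)]
    show "D i a * D j a = p $$ (i, j) * (D j a * D i a)"
      unfolding delta[OF \<open>a < n\<close>] mult_1_right .
  next
    fix i j a b assume ijab: "i < n" "j < n" "a < n" "b < n" "a \<noteq> b"
    \<comment> \<open>A solution pair supported on \<open>a\<close> and \<open>b\<close>: the weight
      q_ab in \<open>?v\<close> is dictated by the equation at \<open>(a, b)\<close>, and the one at
      \<open>(b, a)\<close> then holds by antisymmetry.\<close>
    let ?u = "\<lambda>c. (if c = a then 1 else 0) + (if c = b then 1 else 0) :: 'k"
    let ?v = "\<lambda>c. (if c = a then 1 else 0) + (if c = b then q $$ (a, b) else 0) :: 'k"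
    have "?u c * ?v d = q $$ (c, d) * (?u d * ?v c)" if "c < n" "d < n" for c d
      using q1[OF \<open>a < n\<close>] q1[OF \<open>b < n\<close>] q_inv[OF \<open>a < n\<close> \<open>b < n\<close> \<open>a \<noteq> b\<close>] \<open>a \<noteq> b\<close> by auto
    note pair = D_pair[of ?u ?v, OF this ijab(1,2)]
    have u: "(\<Sum>c<n. D i c * ?u c) = D i a + D i b" for i
      using ijab by (simp add: distrib_left sum.distrib delta)
    have v: "(\<Sum>c<n. D i c * ?v c) = D i a + q $$ (a, b) * D i b" for i
      using ijab by (simp add: distrib_left sum.distrib delta mult.commute)
    show "(D i a + D i b) * (D j a + q $$ (a, b) * D j b) =
      p $$ (i, j) * ((D j a + D j b) * (D i a + q $$ (a, b) * D i b))"
      using pair unfolding u v .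
  qed
qed

section \<open>From isomorphisms to coordinate changes\<close>

lemma algebra_iso_inv_into:
  assumes A: "ring A" and smult: "\<And>c x. x \<in> carrier A \<Longrightarrow> c \<odot>\<^bsub>A\<^esub> x \<in> carrier A"
    and h: "h \<in> algebra_iso A B"
  shows "inv_into (carrier A) h \<in> algebra_iso B A"
proof -
  have iso: "h \<in> ring_iso A B"
    and h_smult: "\<And>c x. x \<in> carrier A \<Longrightarrow> h (c \<odot>\<^bsub>A\<^esub> x) = c \<odot>\<^bsub>B\<^esub> h x"
    using h by (auto simp: algebra_iso_def)
  have bij: "bij_betw h (carrier A) (carrier B)"
    using iso by (simp add: ring_iso_def)
  have "inv_into (carrier A) h (c \<odot>\<^bsub>B\<^esub> y) = c \<odot>\<^bsub>A\<^esub> inv_into (carrier A) h y"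
    if y: "y \<in> carrier B" for c y
  proof -
    obtain x where x: "x \<in> carrier A" "y = h x"
      using y unfolding bij_betw_imp_surj_on[OF bij, symmetric] by blast
    have "inv_into (carrier A) h (h (c \<odot>\<^bsub>A\<^esub> x)) = c \<odot>\<^bsub>A\<^esub> inv_into (carrier A) h (h x)"
      using bij_betw_inv_into_left[OF bij] x(1) smult by simp
    then show ?thesis using h_smult x by simp
  qed
  then show ?thesis
    using ring_iso_set_sym[OF A iso] by (simp add: algebra_iso_def)
qed

text \<open>\<open>F\<close> and \<open>G\<close> lift the images of the generators under
  \<open>h\<close> and its inverse. The choice of lifts is harmless, since evaluation at a solution
  factors through the quotient.\<close>

lemma algebra_iso_coordinate_change:
  assumes h: "h \<in> algebra_iso (quantum_affine_space n p) (quantum_affine_space m q)"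
  shows "\<exists>F G. quantum_coordinate_change n m p q F G"
proof -
  let ?A = "quantum_affine_space n p" and ?B = "quantum_affine_space m q"
  have smult: "c \<odot>\<^bsub>?A\<^esub> x \<in> carrier ?A" if x: "x \<in> carrier ?A" for c x
  proof -
    obtain f where f: "f \<in> carrier (free_algebra n)" "x = quantum_proj n p f"
      using x unfolding quantum_affine_space_carrier by blast
    then have "c \<odot>\<^bsub>?A\<^esub> x = quantum_proj n p (Poly_Mapping.single [] c * f)"
      by (simp only: quantum_proj_smult)
    moreover have "Poly_Mapping.single [] c * f \<in> carrier (free_algebra n)"
      using f by (intro free_algebra_closed)
    ultimately show ?thesis unfolding quantum_affine_space_carrier by blast
  qed
  define k where "k = inv_into (carrier ?A) h"
  have k: "k \<in> algebra_iso ?B ?A"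
    unfolding k_def using ring_quantum_affine_space smult h by (rule algebra_iso_inv_into)
  have bij: "bij_betw h (carrier ?A) (carrier ?B)" "bij_betw k (carrier ?B) (carrier ?A)"
    using h k by (simp_all add: algebra_iso_def ring_iso_def)
  have gen: "quantum_proj N P (gen i) \<in> carrier (quantum_affine_space N P)" if "i < N" for N P i
    unfolding quantum_affine_space_carrier using free_algebra_closed(2)[OF that] by blast
  have "\<exists>f. i < n \<longrightarrow> f \<in> carrier (free_algebra m) \<and>
      h (quantum_proj n p (gen i)) = quantum_proj m q f" for i
    using bij_betwE[OF bij(1)] gen[of i n p] unfolding quantum_affine_space_carrier[of m q] by blast
  then obtain F where F: "\<And>i. i < n \<Longrightarrow> F i \<in> carrier (free_algebra m)"
    and hF: "\<And>i. i < n \<Longrightarrow> h (quantum_proj n p (gen i)) = quantum_proj m q (F i)"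
    by metis
  have "\<exists>f. a < m \<longrightarrow> f \<in> carrier (free_algebra n) \<and>
      k (quantum_proj m q (gen a)) = quantum_proj n p f" for a
    using bij_betwE[OF bij(2)] gen[of a m q] unfolding quantum_affine_space_carrier[of n p] by blast
  then obtain G where G: "\<And>a. a < m \<Longrightarrow> G a \<in> carrier (free_algebra n)"
    and kG: "\<And>a. a < m \<Longrightarrow> k (quantum_proj m q (gen a)) = quantum_proj n p (G a)"
    by metis
  have hG: "h (quantum_proj n p (G a)) = quantum_proj m q (gen a)" if "a < m" for a
    using kG[OF that] bij_betw_inv_into_right[OF bij(1) gen[OF that]] by (simp add: k_def)
  have kF: "k (quantum_proj m q (F i)) = quantum_proj n p (gen i)" if "i < n" for i
    using hF[OF that] bij_betw_inv_into_left[OF bij(1) gen[OF that]] by (simp add: k_def)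
  have "quantum_coordinate_change n m p q F G"
  proof
    show "heis.quantum_tuple n p (\<lambda>i. heis.eval c (F i))" if "heis.quantum_tuple m q c" for c
      using heis.quantum_tuple_algebra_iso[OF h F hF that] .
    show "heis.quantum_tuple m q (\<lambda>a. heis.eval c (G a))" if "heis.quantum_tuple n p c" for c
      using heis.quantum_tuple_algebra_iso[OF k G kG that] .
    show "heis.eval (\<lambda>i. heis.eval c (F i)) (G a) = c a" if "heis.quantum_tuple m q c" "a < m" for c a
      using heis.eval_algebra_iso_inverse[OF h F hF that G[OF that(2)] hG[OF that(2)]] .
    show "heis.eval (\<lambda>a. heis.eval c (G a)) (F i) = c i" if "heis.quantum_tuple n p c" "i < n" for c i
      using heis.eval_algebra_iso_inverse[OF k G kG that F[OF that(2)] kF[OF that(2)]] .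
  qed (use F G in blast)+
  then show ?thesis by blast
qed

section \<open>From permutations to isomorphisms\<close>

lemma quantum_affine_space_isoI:
  assumes F: "\<And>i. i < n \<Longrightarrow> F i \<in> carrier (free_algebra m)"
    and G: "\<And>a. a < m \<Longrightarrow> G a \<in> carrier (free_algebra n)"
    and F_rel: "\<And>i j. \<lbrakk>i < n; j < n\<rbrakk> \<Longrightarrow> free.eval F (quantum_rel p i j) \<in> quantum_ideal m q"
    and G_rel: "\<And>a b. \<lbrakk>a < m; b < m\<rbrakk> \<Longrightarrow> free.eval G (quantum_rel q a b) \<in> quantum_ideal n p"
    and GF: "\<And>i. i < n \<Longrightarrow> free.eval G (F i) = gen i"
    and FG: "\<And>a. a < m \<Longrightarrow> free.eval F (G a) = gen a"
  shows "quantum_affine_space n p \<simeq>\<^sub>a\<^sub>l\<^sub>g quantum_affine_space m q"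
proof -
  let ?A = "quantum_affine_space n p" and ?B = "quantum_affine_space m q"
  let ?R = "carrier (free_algebra n)" and ?S = "carrier (free_algebra m)"
  have Fc: "free.eval F f \<in> ?S" if "f \<in> ?R" for f using that F by (rule free_eval_closed)
  have Gc: "free.eval G f \<in> ?R" if "f \<in> ?S" for f using that G by (rule free_eval_closed)
  have GFf: "free.eval G (free.eval F f) = f" if "f \<in> ?R" for f
    using free.eval_free_eval[OF that, of G F] free.eval_cong[OF that GF] free_eval_gen[OF that] by simp
  have FGf: "free.eval F (free.eval G f) = f" if "f \<in> ?S" for f
    using free.eval_free_eval[OF that, of F G] free.eval_cong[OF that FG] free_eval_gen[OF that] by simp
  \<comment> \<open>Substituting \<open>G\<close> undoes \<open>F\<close>, so \<open>F\<close> both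
    preserves and reflects membership in the ideals. One direction makes the induced map well
    defined, the other makes it injective.\<close>
  have F_eq: "quantum_proj m q (free.eval F f) = quantum_proj m q (free.eval F g) \<longleftrightarrow>
      quantum_proj n p f = quantum_proj n p g" if "f \<in> ?R" "g \<in> ?R" for f g
  proof -
    have "free.eval F (f - g) \<in> quantum_ideal m q \<longleftrightarrow> f - g \<in> quantum_ideal n p"
      using free_eval_quantum_ideal[OF F F_rel, where f = "f - g"]
        free_eval_quantum_ideal[OF G G_rel, where f = "free.eval F (f - g)"]
        GFf[OF free_algebra_closed(4)[OF that]] by auto
    then show ?thesis
      by (simp only: quantum_proj_eq_iff that Fc free.eval_diff)
  qed
  \<comment> \<open>An arbitrary representative of the coset is chosen; \<open>F_eq\<close> makes
    the result independent of it.\<close>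
  define h where "h X = quantum_proj m q (free.eval F (SOME f. f \<in> ?R \<and> quantum_proj n p f = X))" for X
  have h: "h (quantum_proj n p f) = quantum_proj m q (free.eval F f)" if "f \<in> ?R" for f
  proof -
    let ?g = "SOME g. g \<in> ?R \<and> quantum_proj n p g = quantum_proj n p f"
    have "?g \<in> ?R \<and> quantum_proj n p ?g = quantum_proj n p f"
      using that by (intro someI[of "\<lambda>g. g \<in> ?R \<and> quantum_proj n p g = quantum_proj n p f" f]) simp
    then show ?thesis unfolding h_def using F_eq that by blast
  qed
  have one: "(1 :: nat list \<Rightarrow>\<^sub>0 'a) \<in> ?R" by (simp add: zero_list_def)
  have "h \<in> Ring.ring_hom ?A ?B"
  proof (rule ring_hom_memI)
    have "free.eval F 1 = 1"
      by (metis free.eval_const free.scalar_one)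
    then show "h \<one>\<^bsub>?A\<^esub> = \<one>\<^bsub>?B\<^esub>"
      using h[OF one] by (simp only: quantum_proj_one)
  next
    fix X assume "X \<in> carrier ?A"
    then show "h X \<in> carrier ?B"
      unfolding quantum_affine_space_carrier using h Fc by auto
  next
    fix X Y assume "X \<in> carrier ?A" "Y \<in> carrier ?A"
    then obtain f g where fg: "f \<in> ?R" "g \<in> ?R"
      and XY: "X = quantum_proj n p f" "Y = quantum_proj n p g"
      unfolding quantum_affine_space_carrier by blast
    have "h (quantum_proj n p (f * g)) = quantum_proj m q (free.eval F (f * g))"
      using fg by (intro h free_algebra_closed)
    then show "h (X \<otimes>\<^bsub>?A\<^esub> Y) = h X \<otimes>\<^bsub>?B\<^esub> h Y"
      by (simp only: XY h fg free.eval_mult quantum_proj_mult Fc)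
    have "h (quantum_proj n p (f + g)) = quantum_proj m q (free.eval F (f + g))"
      using fg by (intro h free_algebra_closed)
    then show "h (X \<oplus>\<^bsub>?A\<^esub> Y) = h X \<oplus>\<^bsub>?B\<^esub> h Y"
      by (simp only: XY h fg free.eval_add quantum_proj_add Fc)
  qed
  moreover have "bij_betw h (carrier ?A) (carrier ?B)"
  proof (rule bij_betw_imageI)
    show "inj_on h (carrier ?A)"
      unfolding quantum_affine_space_carrier by (auto intro!: inj_onI simp: h F_eq simp del: free_algebra_simps)
    have "quantum_proj m q g \<in> h ` quantum_proj n p ` ?R" if "g \<in> ?S" for g
      using h[OF Gc[OF that]] FGf[OF that] Gc[OF that] by (metis image_eqI)
    then show "h ` carrier ?A = carrier ?B"
      unfolding quantum_affine_space_carrier using h Fc by (auto simp del: free_algebra_simps)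
  qed
  moreover have "h (c \<odot>\<^bsub>?A\<^esub> X) = c \<odot>\<^bsub>?B\<^esub> h X" if "X \<in> carrier ?A" for c X
  proof -
    obtain f where f: "f \<in> ?R" and X: "X = quantum_proj n p f"
      using \<open>X \<in> carrier ?A\<close> unfolding quantum_affine_space_carrier by blast
    have "h (quantum_proj n p (Poly_Mapping.single [] c * f)) =
        quantum_proj m q (free.eval F (Poly_Mapping.single [] c * f))"
      using f by (intro h free_algebra_closed)
    then show ?thesis
      by (simp only: X h f free.eval_mult free.eval_const quantum_proj_smult Fc)
  qed
  ultimately show ?thesis
    unfolding algebra_isomorphic_def algebra_iso_def ring_iso_def by blast
qed

text \<open>Renaming generators along \<open>\<sigma>\<close> turns each relation of
  \<open>p\<close> literally into a relation of \<open>q\<close>, and the inverse permutation undoes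
  the renaming.\<close>

lemma quantum_affine_space_permutation_iso:
  assumes "is_mat_permutation n p q"
  shows "quantum_affine_space n p \<simeq>\<^sub>a\<^sub>l\<^sub>g quantum_affine_space n q"
proof -
  obtain \<sigma> where \<sigma>: "\<sigma> permutes {..<n}"
    and pq: "\<And>i j. \<lbrakk>i < n; j < n\<rbrakk> \<Longrightarrow> p $$ (i, j) = q $$ (\<sigma> i, \<sigma> j)"
    using assms unfolding is_mat_permutation_def by blast
  let ?\<tau> = "inv_into UNIV \<sigma>"
  have lt: "\<sigma> i < n" "?\<tau> i < n" if "i < n" for i
    using permutes_in_image[OF \<sigma>, of i] permutes_in_image[OF permutes_inv[OF \<sigma>], of i] that by simp_all
  show ?thesis
  proof (rule quantum_affine_space_isoI[where F = "\<lambda>i. gen (\<sigma> i)" and G = "\<lambda>i. gen (?\<tau> i)"])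
    fix i j assume ij: "i < n" "j < n"
    have "free.eval (\<lambda>i. gen (\<sigma> i)) (quantum_rel p i j) = quantum_rel q (\<sigma> i) (\<sigma> j)"
      unfolding free.eval_quantum_rel unfolding quantum_rel_def using pq[OF ij] by simp
    then show "free.eval (\<lambda>i. gen (\<sigma> i)) (quantum_rel p i j) \<in> quantum_ideal n q"
      by (simp add: quantum_rel_in_ideal lt ij)
    have "free.eval (\<lambda>i. gen (?\<tau> i)) (quantum_rel q i j) = quantum_rel p (?\<tau> i) (?\<tau> j)"
      unfolding free.eval_quantum_rel unfolding quantum_rel_def
      using pq[OF lt(2)[OF ij(1)] lt(2)[OF ij(2)]] by (simp add: permutes_inverses[OF \<sigma>])
    then show "free.eval (\<lambda>i. gen (?\<tau> i)) (quantum_rel q i j) \<in> quantum_ideal n p"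
      by (simp add: quantum_rel_in_ideal lt ij)
    show "gen (\<sigma> i) \<in> carrier (free_algebra n)" "gen (?\<tau> i) \<in> carrier (free_algebra n)"
      using lt ij(1) by (simp_all only: free_algebra_closed(2))
  qed (simp_all add: free.eval_gen permutes_inverses[OF \<sigma>])
qed

theorem theorem2:
  fixes p q :: "'k::field mat" and n m :: nat
  assumes "n \<ge> 1" and "m \<ge> 1"
    and "p \<in> mult_antisym_mat n" and "q \<in> mult_antisym_mat m"
  shows "quantum_affine_space n p \<simeq>\<^sub>a\<^sub>l\<^sub>g quantum_affine_space m q \<longleftrightarrow>
         m = n \<and> is_mat_permutation n p q"
proof
  assume "quantum_affine_space n p \<simeq>\<^sub>a\<^sub>l\<^sub>g quantum_affine_space m q"
  then obtain F G where "quantum_coordinate_change n m p q F G"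
    unfolding algebra_isomorphic_def using algebra_iso_coordinate_change by blast
  then show "m = n \<and> is_mat_permutation n p q"
    using quantum_coordinate_change.dim_eq quantum_coordinate_change.is_mat_permutation assms(3,4)
    by blast
next
  assume "m = n \<and> is_mat_permutation n p q"
  then show "quantum_affine_space n p \<simeq>\<^sub>a\<^sub>l\<^sub>g quantum_affine_space m q"
    using quantum_affine_space_permutation_iso by blast
qed

end
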